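(* There is no (boldface) $\mathbf{\Pi}^1_1$ base for a Ramsey ultrafilter; that is, if $\mathcal{U}$ is a Ramsey ultrafilter and $X$ is a base for $\mathcal{U}$, then $X$ is not $\mathbf{\Pi}^1_1$.
   Context: Filters are filters on $\omega$ containing all cofinite sets and not containing $\emptyset$; an ultrafilter is a maximal such filter. Subsets of $\omega$ are identified with elements of $2^\omega$ via characteristic functions, and definability of sets of subsets of $\omega$ is in the sense of descriptive set theory. A base for an ultrafilter $\mathcal{U}$ is a set $X \subseteq \mathcal{U}$ such that every $u \in \mathcal{U}$ has a subset $x \subseteq u$ with $x \in X$. For infinite $x,y\subseteq\omega$, $x \subseteq^* y$ means that $x \setminus y$ is finite. An ultrafilter $\mathcal{U}$ is a P-point if for every countable $\mathcal{F} \subseteq \mathcal{U}$ there is $x \in \mathcal{U}$ with $x \subseteq^* y$ for all $y \in \mathcal{F}$; it is a Q-point if for every partition $\langle a_n : n \in \omega\rangle$ of $\omega$ into finite sets there is $x \in \mathcal{U}$ with $|x \cap a_n| \leq 1$ for all $n$. A Ramsey ultrafilter is an ultrafilter that is both a P-point and a Q-point (equivalently, for every $c\colon [\omega]^2 \to 2$ there is $x \in \mathcal{U}$ with $c \restriction [x]^2$ constant). *)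

theory Defs
  imports "HOL-Analysis.Analysis"
begin

section \<open>Filters on the natural numbers\<close>

text \<open>
  Filters are kept as families of sets, so that a base can be a subfamily.
  Only proper filters extending the cofinite filter are considered; in particular
  every ultrafilter below is nonprincipal.
\<close>

definition omega_filter :: "nat set set \<Rightarrow> bool" where
  "omega_filter F \<longleftrightarrow>
     is_filter (\<lambda>P. {n. P n} \<in> F) \<and> {} \<notin> F \<and> (\<forall>A. finite (- A) \<longrightarrow> A \<in> F)"

definition ultrafilter :: "nat set set \<Rightarrow> bool" where
  "ultrafilter U \<longleftrightarrow>
     omega_filter U \<and> (\<forall>G. omega_filter G \<and> U \<subseteq> G \<longrightarrow> G = U)"

definition filter_base :: "nat set set \<Rightarrow> nat set set \<Rightarrow> bool" where
  "filter_base X U \<longleftrightarrow> X \<subseteq> U \<and> (\<forall>u\<in>U. \<exists>x\<in>X. x \<subseteq> u)"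

definition almost_subset :: "nat set \<Rightarrow> nat set \<Rightarrow> bool"  (infix "\<subseteq>\<^sup>*" 50) where
  "x \<subseteq>\<^sup>* y \<longleftrightarrow> finite (x - y)"

definition P_point :: "nat set set \<Rightarrow> bool" where
  "P_point U \<longleftrightarrow>
     ultrafilter U \<and>
     (\<forall>F. F \<subseteq> U \<and> countable F \<longrightarrow> (\<exists>x\<in>U. \<forall>y\<in>F. x \<subseteq>\<^sup>* y))"

definition Q_point :: "nat set set \<Rightarrow> bool" where
  "Q_point U \<longleftrightarrow>
     ultrafilter U \<and>
     (\<forall>a :: nat \<Rightarrow> nat set.
        (\<forall>n. finite (a n) \<and> a n \<noteq> {}) \<and> disjoint_family a \<and> (\<Union>n. a n) = UNIV
        \<longrightarrow> (\<exists>x\<in>U. \<forall>n. card (x \<inter> a n) \<le> 1))"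

definition Ramsey_ultrafilter :: "nat set set \<Rightarrow> bool" where
  "Ramsey_ultrafilter U \<longleftrightarrow> P_point U \<and> Q_point U"

section \<open>Boldface projective classes\<close>

text \<open>
  The types \<^typ>\<open>nat \<Rightarrow> bool\<close> and \<^typ>\<open>nat \<Rightarrow> nat\<close>, with the product topology of
  discrete spaces, are Cantor space and Baire space. A set is boldface \<open>\<Sigma>\<^sup>1\<^sub>1\<close>
  (analytic) if it is the projection of a closed set along Baire space.
\<close>

definition boldface_Sigma11 :: "(nat \<Rightarrow> bool) set \<Rightarrow> bool" where
  "boldface_Sigma11 A \<longleftrightarrow>
     (\<exists>C :: ((nat \<Rightarrow> bool) \<times> (nat \<Rightarrow> nat)) set. closed C \<and> A = fst ` C)"

definition boldface_Pi11 :: "(nat \<Rightarrow> bool) set \<Rightarrow> bool" where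
  "boldface_Pi11 A \<longleftrightarrow> boldface_Sigma11 (- A)"

definition char_fun :: "nat set \<Rightarrow> (nat \<Rightarrow> bool)" where
  "char_fun x = (\<lambda>n. n \<in> x)"

end

theory Submission
  imports Defs
begin

text \<open>
  A Ramsey ultrafilter \<open>U\<close> decides analytic sets (Mathias): if \<open>A\<close> is analytic, then some
  \<open>u \<in> U\<close> has either all of its infinite subsets in \<open>A\<close> or none of them
  (\<open>analytic_homogeneous\<close>). Let \<open>X\<close> be a coanalytic base of \<open>U\<close> and apply this to its complement.
  If no infinite subset of \<open>u\<close> is in \<open>X\<close>, then \<open>X\<close> contains no subset of \<open>u\<close>, and it is not a base.
  If every infinite subset of \<open>u\<close> is in \<open>X \<subseteq> U\<close>, then splitting \<open>u\<close> into two infinite halves puts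
  two disjoint sets into \<open>U\<close>. Both are absurd.

  To prove the theorem of Mathias, write \<open>[s,u]\<close> for the infinite sets with the finite initial
  segment \<open>s\<close> and all other elements in \<open>u\<close>. Being Ramsey is used through fusion
  (\<open>Ramsey_fusion\<close>): given a set \<open>V t \<in> U\<close> for every finite \<open>t\<close>, a single \<open>u \<in> U\<close> is such
  that each element of \<open>[s,u]\<close> lies in \<open>[t, V t]\<close> for all of its finite initial segments
  \<open>t \<supseteq> s\<close>. A first use of fusion, together with maximality of \<open>U\<close>, gives the open
  (Nash-Williams) case: for every family \<open>T\<close> of finite sets there is some \<open>[s,u]\<close> such that either
  all or none of its elements have an initial segment \<open>t \<supseteq> s\<close> in \<open>T\<close>
  (\<open>Nash_Williams_dichotomy\<close>).

  Now let \<open>A\<close> be the projection of a closed set \<open>C\<close>, and let \<open>A\<^sub>\<sigma>\<close> consist of the points of \<open>A\<close> with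
  a witness extending the finite sequence \<open>\<sigma>\<close>. Say that \<open>s\<close> rejects \<open>\<sigma>\<close> if some \<open>[s,u]\<close> with
  \<open>u \<in> U\<close> misses \<open>A\<^sub>\<sigma>\<close>. If \<open>s\<close> does not reject \<open>\<sigma>\<close>, then on some \<open>[s,u]\<close> every point has a finite
  initial segment \<open>t\<close> that does not reject some one-step extension of \<open>\<sigma>\<close>; otherwise all those
  rejections could be fused into a rejection of \<open>\<sigma>\<close> by \<open>s\<close>, because
  \<open>A\<^sub>\<sigma>\<close> is the union of the sets for its one-step extensions. Hence, if the empty set does not reject
  the empty sequence, a last fusion gives \<open>u \<in> U\<close> such that along every infinite \<open>y \<subseteq> u\<close> one can
  build a full witness digit by digit. The pair of \<open>y\<close> and this witness is a limit of points of
  \<open>C\<close>, so \<open>y \<in> A\<close>.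

  For fusion only finitely many sequences may be treated at each \<open>t\<close>. This is why the sequence
  attached to \<open>t\<close> is always required to have length and entries at most \<open>card t\<close>: waiting for a longer
  initial segment makes room for any prescribed digit.
\<close>

section \<open>Ultrafilters on the natural numbers\<close>

lemma omega_filterD:
  assumes "omega_filter F"
  shows omega_filter_Int: "\<And>A B. A \<in> F \<Longrightarrow> B \<in> F \<Longrightarrow> A \<inter> B \<in> F"
    and omega_filter_mono: "\<And>A B. A \<in> F \<Longrightarrow> A \<subseteq> B \<Longrightarrow> B \<in> F"
    and omega_filter_UNIV: "UNIV \<in> F"
    and omega_filter_nonempty: "{} \<notin> F"
    and omega_filter_cofinite: "\<And>A. finite (- A) \<Longrightarrow> A \<in> F"
proof -
  from assms interpret is_filter "\<lambda>P. {n. P n} \<in> F"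
    by (simp add: omega_filter_def)
  show "A \<inter> B \<in> F" if "A \<in> F" "B \<in> F" for A B
    using conj[of "\<lambda>n. n \<in> A" "\<lambda>n. n \<in> B"] that by (simp add: Int_def)
  show "B \<in> F" if "A \<in> F" "A \<subseteq> B" for A B
    using mono[of "\<lambda>n. n \<in> A" "\<lambda>n. n \<in> B"] that by auto
  show "UNIV \<in> F" using True by simp
  show "{} \<notin> F" "\<And>A. finite (- A) \<Longrightarrow> A \<in> F"
    using assms by (auto simp: omega_filter_def)
qed

lemma ultrafilter_omega_filter: "ultrafilter U \<Longrightarrow> omega_filter U"
  by (simp add: ultrafilter_def)

lemma omega_filter_INT:
  assumes "omega_filter F" "finite I" "\<And>i. i \<in> I \<Longrightarrow> V i \<in> F"
  shows "(\<Inter>i\<in>I. V i) \<in> F"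
  using assms(2,3)
  by (induction I) (auto intro: omega_filter_UNIV omega_filter_Int assms(1))

lemma omega_filter_infinite:
  assumes "omega_filter F" "A \<in> F"
  shows "infinite A"
proof
  assume "finite A"
  then have "A \<inter> - A \<in> F"
    by (intro omega_filter_Int omega_filter_cofinite assms) simp
  then show False using omega_filter_nonempty[OF assms(1)] by simp
qed

text \<open>If \<open>- A \<notin> U\<close>, then \<open>A\<close> meets every member of \<open>U\<close>, so that \<open>U\<close> and \<open>A\<close> generate a proper
  filter, which is \<open>U\<close> by maximality.\<close>

lemma ultrafilter_Compl_cases:
  assumes U: "ultrafilter U"
  shows "A \<in> U \<or> - A \<in> U"
proof (rule disjCI)
  assume nA: "- A \<notin> U"
  note F = ultrafilter_omega_filter[OF U]
  define G where "G = {B. \<exists>C\<in>U. C \<inter> A \<subseteq> B}"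
  have "is_filter (\<lambda>P. {n. P n} \<in> G)"
  proof
    show "{n. True} \<in> G" using omega_filter_UNIV[OF F] by (auto simp: G_def)
    show "{x. P x \<and> Q x} \<in> G" if PQ: "{x. P x} \<in> G" "{x. Q x} \<in> G" for P Q
    proof -
      from PQ obtain C D where "C \<in> U" "C \<inter> A \<subseteq> {x. P x}" "D \<in> U" "D \<inter> A \<subseteq> {x. Q x}"
        by (auto simp: G_def)
      then have "C \<inter> D \<in> U" "(C \<inter> D) \<inter> A \<subseteq> {x. P x \<and> Q x}"
        by (auto intro: omega_filter_Int[OF F])
      then show ?thesis unfolding G_def by blast
    qed
    show "{x. Q x} \<in> G" if "\<forall>x. P x \<longrightarrow> Q x" "{x. P x} \<in> G" for P Q
      using that unfolding G_def by blast
  qed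
  moreover have "{} \<notin> G"
    using omega_filter_mono[OF F, of _ "- A"] nA by (auto simp: G_def)
  moreover have UG: "U \<subseteq> G" unfolding G_def by blast
  ultimately have "omega_filter G"
    using omega_filter_cofinite[OF F] by (auto simp: omega_filter_def)
  with U UG have "G = U" by (auto simp: ultrafilter_def)
  moreover have "A \<in> G" using omega_filter_UNIV[OF F] by (auto simp: G_def)
  ultimately show "A \<in> U" by simp
qed

section \<open>Diagonal intersections in Ramsey ultrafilters\<close>

lemma Ramsey_ultrafilterD: "Ramsey_ultrafilter U \<Longrightarrow> ultrafilter U"
  by (simp add: Ramsey_ultrafilter_def P_point_def)

text \<open>The Q-point property for the partition into the intervals \<open>[g i, g (i + 1))\<close>. Picking one point
  from each interval is not enough to separate points from adjacent intervals; restricting to the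
  intervals of one parity, whichever lies in the ultrafilter, leaves a full interval between
  any two points.\<close>

lemma Q_point_sparse:
  fixes f :: "nat \<Rightarrow> nat"
  assumes Q: "Q_point U"
  obtains z where "z \<in> U" "\<And>n m. n \<in> z \<Longrightarrow> m \<in> z \<Longrightarrow> n < m \<Longrightarrow> f n \<le> m"
proof -
  have U: "ultrafilter U" using Q by (simp add: Q_point_def)
  note F = ultrafilter_omega_filter[OF U]
  \<comment> \<open>The sum is just a bound for all \<open>f n\<close> with \<open>n < m\<close>.\<close>
  define h where "h m = Suc m + (\<Sum>n<m. f n)" for m
  define g where "g i = (h ^^ i) 0" for i
  have g0: "g 0 = 0" and gSuc: "g (Suc i) = h (g i)" for i by (simp_all add: g_def)
  have mono: "strict_mono g" by (rule strict_monoI_Suc) (simp add: gSuc h_def)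
  have gf: "f n \<le> g (Suc i)" if "n < g i" for n i
    using member_le_sum[of n "{..<g i}" f] that by (simp add: gSuc h_def)
  define a where "a i = {g i..<g (Suc i)}" for i
  define idx where "idx n = (LEAST i. n < g (Suc i))" for n
  have idx: "n \<in> a (idx n)" for n
  proof -
    have "n < g (Suc n)" using strict_mono_imp_increasing[OF mono, of "Suc n"] by simp
    then have 1: "n < g (Suc (idx n))" unfolding idx_def by (rule LeastI)
    have "g (idx n) \<le> n"
    proof (cases "idx n")
      case (Suc j)
      then show ?thesis using not_less_Least[of j "\<lambda>i. n < g (Suc i)"] by (simp add: idx_def)
    qed (simp add: g0)
    with 1 show ?thesis by (simp add: a_def)
  qed
  have a_less: "Suc i \<le> j" if "n \<in> a i" "m \<in> a j" "n < m" "i \<noteq> j" for i j n m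
  proof (rule ccontr)
    assume "\<not> Suc i \<le> j"
    with that(4) have "Suc j \<le> i" by simp
    then have "g (Suc j) \<le> g i" by (simp add: strict_mono_less_eq[OF mono])
    with that show False by (simp add: a_def)
  qed
  have disj: "disjoint_family a"
  proof (unfold disjoint_family_on_def, intro ballI impI)
    have "g (Suc j) \<le> g i" if "j < i" for i j
      using that by (simp add: strict_mono_less_eq[OF mono])
    then have lt: "a i \<inter> a j = {}" if "j < i" for i j
      using that by (fastforce simp: a_def)
    fix i j :: nat assume "i \<noteq> j"
    then show "a i \<inter> a j = {}" using lt[of i j] lt[of j i] by (metis Int_commute nat_neq_iff)
  qed
  have "\<forall>n. finite (a n) \<and> a n \<noteq> {}" using strict_monoD[OF mono] by (auto simp: a_def)
  moreover have "(\<Union>n. a n) = UNIV" using idx by auto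
  ultimately obtain x where x: "x \<in> U" "\<And>n. card (x \<inter> a n) \<le> 1"
    using Q disj by (auto simp: Q_point_def)
  obtain p where p: "p \<in> U" "\<And>n m. n \<in> p \<Longrightarrow> m \<in> p \<Longrightarrow> even (idx n) = even (idx m)"
  proof (cases "{n. even (idx n)} \<in> U")
    case False
    then have "- {n. even (idx n)} \<in> U" using ultrafilter_Compl_cases[OF U] by blast
    then show ?thesis by (rule that) simp
  qed (use that in blast)
  show thesis
  proof
    show "x \<inter> p \<in> U" using x p by (intro omega_filter_Int[OF F])
    fix n m assume nm: "n \<in> x \<inter> p" "m \<in> x \<inter> p" "n < m"
    have "idx n \<noteq> idx m"
    proof
      assume "idx n = idx m"
      then have "{n, m} \<subseteq> x \<inter> a (idx n)" using nm idx[of n] idx[of m] by auto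
      then have "card {n, m} \<le> card (x \<inter> a (idx n))" by (intro card_mono) (auto simp: a_def)
      with x(2)[of "idx n"] nm show False by simp
    qed
    with a_less[OF idx idx nm(3)] p(2)[of n m] nm have "Suc (Suc (idx n)) \<le> idx m"
      by (metis IntD2 Suc_leI even_Suc le_neq_implies_less)
    then have "g (Suc (Suc (idx n))) \<le> g (idx m)" by (simp add: strict_mono_less_eq[OF mono])
    moreover have "f n \<le> g (Suc (Suc (idx n)))" using idx[of n] by (intro gf) (simp add: a_def)
    moreover have "g (idx m) \<le> m" using idx[of m] by (simp add: a_def)
    ultimately show "f n \<le> m" by simp
  qed
qed

text \<open>The P-point property gives \<open>x \<in> U\<close> almost contained in every \<open>v n\<close>; thinning \<open>x\<close> out so that its
  elements grow fast enough removes the finite exceptions.\<close>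

lemma Ramsey_diagonal:
  assumes R: "Ramsey_ultrafilter U" and v: "\<And>n. v n \<in> U"
  obtains u where "u \<in> U" "\<And>n m. n \<in> u \<Longrightarrow> m \<in> u \<Longrightarrow> n < m \<Longrightarrow> m \<in> v n"
proof -
  note F = ultrafilter_omega_filter[OF Ramsey_ultrafilterD[OF R]]
  have "range v \<subseteq> U" "countable (range v)" using v by auto
  then obtain x where x: "x \<in> U" "\<And>n. finite (x - v n)"
    using R unfolding Ramsey_ultrafilter_def P_point_def almost_subset_def by (metis rangeI)
  have "\<exists>b. \<forall>m\<in>x - v n. m < b" for n
    using x(2)[of n] by (simp add: finite_nat_set_iff_bounded)
  then obtain f where f: "\<And>n m. m \<in> x - v n \<Longrightarrow> m < f n" by metis
  obtain z where z: "z \<in> U" "\<And>n m. n \<in> z \<Longrightarrow> m \<in> z \<Longrightarrow> n < m \<Longrightarrow> f n \<le> m"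
    using R Q_point_sparse[of U f] by (auto simp: Ramsey_ultrafilter_def)
  show thesis
  proof
    show "x \<inter> z \<in> U" using x z by (intro omega_filter_Int[OF F])
    show "m \<in> v n" if "n \<in> x \<inter> z" "m \<in> x \<inter> z" "n < m" for n m
      using z(2)[of n m] f[of m n] that by (meson Diff_iff IntD1 IntD2 linorder_not_le)
  qed
qed

section \<open>Fusion\<close>

text \<open>A basic open set of the Ellentuck topology. In particular, \<open>y \<in> stem s UNIV\<close> says that \<open>s\<close> is
  an initial segment of the infinite set \<open>y\<close>.\<close>

definition stem :: "nat set \<Rightarrow> nat set \<Rightarrow> nat set set" where
  "stem s u = {y. infinite y \<and> s \<subseteq> y \<and> (\<forall>m\<in>y - s. m \<in> u \<and> (\<forall>k\<in>s. k < m))}"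

lemma stem_mono: "u \<subseteq> v \<Longrightarrow> stem s u \<subseteq> stem s v"
  by (auto simp: stem_def)

lemma stem_UNIV: "y \<in> stem s u \<Longrightarrow> y \<in> stem s UNIV"
  using stem_mono by blast

lemma stem_empty: "y \<in> stem {} u \<longleftrightarrow> infinite y \<and> y \<subseteq> u"
  by (auto simp: stem_def)

text \<open>A diagonal intersection of the sets \<open>\<Inter>{V t | t \<subseteq> {..n}}\<close> handles every nonempty \<open>t\<close> whose
  maximum lies in \<open>u\<close>. Finitely many more sets handle \<open>t = {}\<close> and the maxima in \<open>s\<close>, which need
  not be in \<open>u\<close>.\<close>

lemma Ramsey_fusion:
  assumes R: "Ramsey_ultrafilter U" and s: "finite s" and V: "\<And>t. finite t \<Longrightarrow> V t \<in> U"
  obtains u where "u \<in> U"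
    "\<And>y t. y \<in> stem s u \<Longrightarrow> finite t \<Longrightarrow> s \<subseteq> t \<Longrightarrow> y \<in> stem t UNIV \<Longrightarrow> y \<in> stem t (V t)"
proof -
  note F = ultrafilter_omega_filter[OF Ramsey_ultrafilterD[OF R]]
  define v where "v n = (\<Inter>t\<in>Pow {..n}. V t)" for n :: nat
  have v: "v n \<in> U" for n unfolding v_def
    by (intro omega_filter_INT[OF F] V) (auto intro: finite_subset)
  obtain u0 where u0: "u0 \<in> U" "\<And>n m. n \<in> u0 \<Longrightarrow> m \<in> u0 \<Longrightarrow> n < m \<Longrightarrow> m \<in> v n"
    using Ramsey_diagonal[of U v, OF R v] by blast
  define u where "u = u0 \<inter> (\<Inter>n\<in>s. v n) \<inter> V {}"
  show thesis
  proof
    show "u \<in> U" unfolding u_def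
      by (intro omega_filter_Int[OF F] omega_filter_INT[OF F] u0 s v V) simp
    fix y t assume y: "y \<in> stem s u" and t: "finite t" "s \<subseteq> t" and yt: "y \<in> stem t UNIV"
    have "m \<in> V t" if m: "m \<in> y - t" for m
    proof (cases "t = {}")
      case True
      then show ?thesis using y m t by (auto simp: stem_def u_def)
    next
      case False
      have mu: "m \<in> u" using y m t by (auto simp: stem_def)
      have Mt: "Max t \<in> t" using t False by simp
      then have "Max t \<in> y" "Max t < m" using yt m by (auto simp: stem_def)
      then have "m \<in> v (Max t)"
        using y mu u0(2)[of "Max t" m] by (cases "Max t \<in> s") (auto simp: stem_def u_def)
      moreover have "t \<subseteq> {..Max t}" using t by auto
      ultimately show ?thesis by (auto simp: v_def)
    qed
    with yt show "y \<in> stem t (V t)" by (auto simp: stem_def)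
  qed
qed

text \<open>Call \<open>t\<close> accepting if the first alternative holds with \<open>t\<close> for \<open>s\<close>. If \<open>t\<close> is not accepting,
  then \<open>t \<union> {k}\<close> is not accepting for \<open>U\<close>-almost all \<open>k\<close>: otherwise it is accepting for
  \<open>U\<close>-almost all \<open>k\<close>, and fusing the witnesses makes \<open>t\<close> accepting. Fusing these sets of \<open>k\<close>
  gives \<open>u\<close> such that nothing between \<open>s\<close> and a member of \<open>stem s u\<close> is accepting, while members of
  \<open>T\<close> are accepting trivially.\<close>

lemma Nash_Williams_dichotomy:
  assumes R: "Ramsey_ultrafilter U" and s: "finite s"
  shows "(\<exists>u\<in>U. \<forall>y\<in>stem s u. \<exists>t\<in>T. finite t \<and> s \<subseteq> t \<and> y \<in> stem t UNIV) \<or>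
         (\<exists>u\<in>U. \<forall>y\<in>stem s u. \<forall>t. finite t \<longrightarrow> s \<subseteq> t \<longrightarrow> y \<in> stem t UNIV \<longrightarrow> t \<notin> T)"
proof -
  note UF = Ramsey_ultrafilterD[OF R]
  note F = ultrafilter_omega_filter[OF UF]
  define good where "good t y \<longleftrightarrow> (\<exists>r\<in>T. finite r \<and> t \<subseteq> r \<and> y \<in> stem r UNIV)" for t y
  define acc where "acc t \<longleftrightarrow> (\<exists>u\<in>U. \<forall>y\<in>stem t u. good t y)" for t
  define N where "N t = {k. (\<forall>j\<in>t. j < k) \<longrightarrow> \<not> acc (insert k t)}" for t
  have "N t \<in> U" if t: "finite t" "\<not> acc t" for t
  proof (rule ccontr)
    assume "N t \<notin> U"
    then have K: "- N t \<in> U" using ultrafilter_Compl_cases[OF UF] by blast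
    have "\<forall>r. \<exists>V\<in>U. acc r \<longrightarrow> (\<forall>y\<in>stem r V. good r y)"
      using omega_filter_UNIV[OF F] unfolding acc_def by blast
    then obtain V where V: "\<And>r. V r \<in> U" "\<And>r y. acc r \<Longrightarrow> y \<in> stem r (V r) \<Longrightarrow> good r y"
      by metis
    obtain u where u: "u \<in> U"
      "\<And>y r. y \<in> stem t u \<Longrightarrow> finite r \<Longrightarrow> t \<subseteq> r \<Longrightarrow> y \<in> stem r UNIV \<Longrightarrow> y \<in> stem r (V r)"
      using Ramsey_fusion[of U t V, OF R t(1) V(1)] by blast
    have "good t y" if y: "y \<in> stem t (u \<inter> - N t)" for y
    proof -
      have "infinite (y - t)" using y t by (simp add: stem_def)
      then have "y - t \<noteq> {}" by force
      then obtain k where k: "k \<in> y - t" "\<And>m. m \<in> y - t \<Longrightarrow> k \<le> m"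
        using LeastI_ex[of "\<lambda>k. k \<in> y - t"] Least_le[of "\<lambda>k. k \<in> y - t"] by blast
      have "y \<in> stem (insert k t) UNIV"
        using y k by (force simp: stem_def)
      then have "y \<in> stem (insert k t) (V (insert k t))"
        using stem_mono[of "u \<inter> - N t" u t] y t(1) by (intro u) auto
      moreover have "acc (insert k t)" using y k by (auto simp: stem_def N_def)
      ultimately have "good (insert k t) y" by (intro V)
      then show ?thesis unfolding good_def by blast
    qed
    moreover have "u \<inter> - N t \<in> U" using u K by (intro omega_filter_Int[OF F])
    ultimately have "acc t" unfolding acc_def by blast
    with t show False by simp
  qed
  then have N: "(if acc t then UNIV else N t) \<in> U" if "finite t" for t
    using that omega_filter_UNIV[OF F] by simp
  show ?thesis
  proof (cases "acc s")
    case True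
    then show ?thesis unfolding acc_def good_def by blast
  next
    case nacc: False
    obtain u where u: "u \<in> U"
      "\<And>y t. y \<in> stem s u \<Longrightarrow> finite t \<Longrightarrow> s \<subseteq> t \<Longrightarrow> y \<in> stem t UNIV \<Longrightarrow>
         y \<in> stem t (if acc t then UNIV else N t)"
      using Ramsey_fusion[of U s "\<lambda>t. if acc t then UNIV else N t", OF R s N] by blast
    have "\<not> acc t" if y: "y \<in> stem s u" and "finite t" "s \<subseteq> t" "y \<in> stem t UNIV" for y t
      using that(2-4)
    proof (induction "card (t - s)" arbitrary: t)
      case 0
      then have "t = s" by auto
      with nacc show ?case by simp
    next
      case (Suc n)
      then have ne: "t - s \<noteq> {}" "finite (t - s)" by auto
      define k where "k = Max (t - s)"
      have k: "k \<in> t - s" "\<And>j. j \<in> t - s \<Longrightarrow> j \<le> k" using Max_in[OF ne(2,1)] Max_ge[OF ne(2)] by (simp_all add: k_def)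
      have ky: "k \<in> y" using Suc.prems k by (auto simp: stem_def)
      then have sk: "j < k" if "j \<in> s" for j using y k that by (auto simp: stem_def)
      have tk: "j < k" if "j \<in> t - {k}" for j
        using that sk k(2)[of j] by (cases "j \<in> s") (auto simp: order.strict_iff_order)
      have t': "y \<in> stem (t - {k}) UNIV" using Suc.prems tk by (auto simp: stem_def)
      have "card (t - {k} - s) = n"
        using Suc.hyps(2) k(1) ne(2)
        by (metis Diff_insert Diff_insert2 card_Diff_singleton diff_Suc_1)
      then have "\<not> acc (t - {k})" using Suc.prems t' k by (intro Suc.hyps(1)) auto
      then have "y \<in> stem (t - {k}) (N (t - {k}))"
        using u(2)[OF y _ _ t'] Suc.prems k by auto
      then have "k \<in> N (t - {k})" using ky by (auto simp: stem_def)
      then have "\<not> acc (insert k (t - {k}))" using tk by (simp add: N_def)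
      then show ?case using k by (simp add: insert_absorb)
    qed
    moreover have "acc t" if "t \<in> T" "finite t" for t
      using that omega_filter_UNIV[OF F] stem_UNIV unfolding acc_def good_def by blast
    ultimately show ?thesis using u(1) by blast
  qed
qed

section \<open>Homogeneous sets for analytic sets\<close>

text \<open>The points of the projection of \<open>C\<close> that have a witness extending \<open>\<sigma>\<close>.\<close>

definition proj_through ::
    "((nat \<Rightarrow> bool) \<times> (nat \<Rightarrow> nat)) set \<Rightarrow> nat list \<Rightarrow> nat set set" where
  "proj_through C \<sigma> = {y. \<exists>\<tau>. (char_fun y, \<tau>) \<in> C \<and> (\<forall>i<length \<sigma>. \<tau> i = \<sigma> ! i)}"

lemma proj_through_Nil: "y \<in> proj_through C [] \<longleftrightarrow> char_fun y \<in> fst ` C"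
  by (force simp: proj_through_def)

lemma proj_through_extend:
  assumes "y \<in> proj_through C \<sigma>"
  obtains d where "y \<in> proj_through C (\<sigma> @ [d])"
proof -
  from assms obtain \<tau> where "(char_fun y, \<tau>) \<in> C" "\<forall>i<length \<sigma>. \<tau> i = \<sigma> ! i"
    by (auto simp: proj_through_def)
  then have "y \<in> proj_through C (\<sigma> @ [\<tau> (length \<sigma>)])"
    by (auto simp: proj_through_def nth_append less_Suc_eq)
  then show thesis by (rule that)
qed

definition rejects :: "nat set set \<Rightarrow> ((nat \<Rightarrow> bool) \<times> (nat \<Rightarrow> nat)) set \<Rightarrow>
    nat set \<Rightarrow> nat list \<Rightarrow> bool" where
  "rejects U C s \<sigma> \<longleftrightarrow> (\<exists>u\<in>U. stem s u \<inter> proj_through C \<sigma> = {})"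

definition small_seqs :: "nat \<Rightarrow> nat list set" where
  "small_seqs n = {\<sigma>. set \<sigma> \<subseteq> {..n} \<and> length \<sigma> \<le> n}"

lemma finite_small_seqs: "finite (small_seqs n)"
  unfolding small_seqs_def by (rule finite_lists_length_le) simp

lemma small_seqs_mono: "m \<le> n \<Longrightarrow> small_seqs m \<subseteq> small_seqs n"
  by (auto simp: small_seqs_def)

lemma small_seqs_eventually: "\<exists>n. \<sigma> \<in> small_seqs n"
proof -
  have "set \<sigma> \<subseteq> {..length \<sigma> + sum_list \<sigma>}"
    by (auto intro: order_trans[OF member_le_sum_list])
  then show ?thesis by (intro exI[of _ "length \<sigma> + sum_list \<sigma>"]) (simp add: small_seqs_def)
qed

lemma stem_long_segment:
  assumes y: "y \<in> stem s UNIV" and s: "finite s"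
  obtains t where "finite t" "s \<subseteq> t" "y \<in> stem t UNIV" "N \<le> card t"
proof -
  have inf: "infinite y" and sy: "s \<subseteq> y" using y by (auto simp: stem_def)
  obtain B where B: "finite B" "card B = N" "B \<subseteq> y"
    using infinite_arbitrarily_large[OF inf] by blast
  from s B have "finite (s \<union> B)" by simp
  then obtain n where n: "\<forall>k\<in>s \<union> B. k \<le> n" using finite_nat_set_iff_bounded_le by blast
  show thesis
  proof (rule that[of "y \<inter> {..n}"])
    show "y \<in> stem (y \<inter> {..n}) UNIV" using inf by (auto simp: stem_def)
    have "card B \<le> card (y \<inter> {..n})" using n B by (intro card_mono) auto
    then show "N \<le> card (y \<inter> {..n})" using B by simp
  qed (use n sy in auto)
qed

text \<open>By the Nash-Williams dichotomy the only other case is that on some \<open>stem s u\<close> all initial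
  segments \<open>t \<supseteq> s\<close> reject all the small one-step extensions of \<open>\<sigma>\<close>. After fusing these rejections, a point of
  \<open>stem s u\<close> with a witness through \<open>\<sigma>\<close> is impossible: the next digit of its witness is small with
  respect to some longer initial segment, which rejects it. So \<open>s\<close> rejects \<open>\<sigma>\<close>.\<close>

lemma not_rejects_extend:
  assumes R: "Ramsey_ultrafilter U" and s: "finite s" and nrej: "\<not> rejects U C s \<sigma>"
  shows "\<exists>u\<in>U. \<forall>y\<in>stem s u. \<exists>t d. finite t \<and> y \<in> stem t UNIV \<and>
           \<sigma> @ [d] \<in> small_seqs (card t) \<and> \<not> rejects U C t (\<sigma> @ [d])"
proof -
  note F = ultrafilter_omega_filter[OF Ramsey_ultrafilterD[OF R]]
  define T where
    "T = {t. \<exists>d. \<sigma> @ [d] \<in> small_seqs (card t) \<and> \<not> rejects U C t (\<sigma> @ [d])}"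
  from Nash_Williams_dichotomy[OF R s, of T] show ?thesis
  proof
    assume "\<exists>u\<in>U. \<forall>y\<in>stem s u. \<exists>t\<in>T. finite t \<and> s \<subseteq> t \<and> y \<in> stem t UNIV"
    then obtain u where u: "u \<in> U"
      "\<And>y. y \<in> stem s u \<Longrightarrow> \<exists>t\<in>T. finite t \<and> s \<subseteq> t \<and> y \<in> stem t UNIV"
      by meson
    show ?thesis
    proof (rule bexI[OF _ u(1)], rule ballI)
      fix y assume "y \<in> stem s u"
      then obtain t where t: "t \<in> T" "finite t" "y \<in> stem t UNIV" using u(2) by meson
      moreover from t(1) obtain d
        where "\<sigma> @ [d] \<in> small_seqs (card t)" "\<not> rejects U C t (\<sigma> @ [d])"
        by (auto simp: T_def)
      ultimately show "\<exists>t d. finite t \<and> y \<in> stem t UNIV \<and>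
          \<sigma> @ [d] \<in> small_seqs (card t) \<and> \<not> rejects U C t (\<sigma> @ [d])" by meson
    qed
  next
    assume "\<exists>u\<in>U. \<forall>y\<in>stem s u. \<forall>t. finite t \<longrightarrow> s \<subseteq> t \<longrightarrow>
        y \<in> stem t UNIV \<longrightarrow> t \<notin> T"
    then obtain u where u: "u \<in> U"
      "\<And>y t. y \<in> stem s u \<Longrightarrow> finite t \<Longrightarrow> s \<subseteq> t \<Longrightarrow> y \<in> stem t UNIV \<Longrightarrow> t \<notin> T"
      by meson
    have "\<forall>t \<rho>. \<exists>W\<in>U. rejects U C t \<rho> \<longrightarrow> stem t W \<inter> proj_through C \<rho> = {}"
      using omega_filter_UNIV[OF F] unfolding rejects_def by blast
    then obtain W where W: "\<And>t \<rho>. W t \<rho> \<in> U"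
      "\<And>t \<rho>. rejects U C t \<rho> \<Longrightarrow> stem t (W t \<rho>) \<inter> proj_through C \<rho> = {}"
      by metis
    define V where "V t = (\<Inter>\<rho>\<in>small_seqs (card t). W t \<rho>)" for t
    have V: "V t \<in> U" for t
      unfolding V_def by (intro omega_filter_INT[OF F] finite_small_seqs W)
    obtain v where v: "v \<in> U"
      "\<And>y t. y \<in> stem s v \<Longrightarrow> finite t \<Longrightarrow> s \<subseteq> t \<Longrightarrow> y \<in> stem t UNIV \<Longrightarrow> y \<in> stem t (V t)"
      using Ramsey_fusion[of U s V, OF R s V] by blast
    have "y \<notin> proj_through C \<sigma>" if y: "y \<in> stem s (u \<inter> v)" for y
    proof
      assume "y \<in> proj_through C \<sigma>"
      then obtain d where d: "y \<in> proj_through C (\<sigma> @ [d])" by (rule proj_through_extend)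
      obtain n where n: "\<sigma> @ [d] \<in> small_seqs n" using small_seqs_eventually by blast
      obtain t where t: "finite t" "s \<subseteq> t" "y \<in> stem t UNIV" "n \<le> card t"
        using stem_long_segment[OF stem_UNIV[OF y] s] by blast
      have small: "\<sigma> @ [d] \<in> small_seqs (card t)" using n t(4) small_seqs_mono by blast
      have "y \<in> stem s u" "y \<in> stem s v" using y stem_mono by blast+
      with u(2)[OF _ t(1-3)] v(2)[OF _ t(1-3)]
      have "t \<notin> T" "y \<in> stem t (V t)" by blast+
      with small have "rejects U C t (\<sigma> @ [d])" "y \<in> stem t (W t (\<sigma> @ [d]))"
        using stem_mono[of "V t" "W t (\<sigma> @ [d])" t] by (auto simp: T_def V_def)
      with W(2) d show False by blast
    qed
    moreover have "u \<inter> v \<in> U" using u(1) v(1) by (intro omega_filter_Int[OF F])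
    ultimately have "rejects U C s \<sigma>" unfolding rejects_def by blast
    with nrej show ?thesis by simp
  qed
qed

lemma tendsto_discrete_pointwise:
  fixes f :: "nat \<Rightarrow> nat \<Rightarrow> 'a::discrete_topology"
  assumes "\<And>i n. i < n \<Longrightarrow> f n i = l i"
  shows "f \<longlonglongrightarrow> l"
proof -
  have "(\<lambda>n. f n i) \<longlonglongrightarrow> l i" for i
    by (rule tendsto_eventually, rule eventually_mono[OF eventually_gt_at_top[of i]]) (rule assms)
  then have "limitin (product_topology (\<lambda>_. euclidean) UNIV) f l sequentially"
    by (simp add: limitin_componentwise)
  then show ?thesis by (simp add: euclidean_product_topology)
qed

text \<open>If \<open>t\<close> does not reject \<open>\<sigma>\<close>, then some point with initial segment \<open>t\<close> has a witness
  extending \<open>\<sigma>\<close>. The points taken at the stages of the chain approximate \<open>y\<close>, and their witnesses approximate the limit of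
  the sequences; closedness of \<open>C\<close> passes to the limit.\<close>

lemma not_rejects_chain_limit:
  assumes U: "ultrafilter U" and C: "closed C"
    and t: "\<And>i. finite (t i)" "\<And>i. y \<in> stem (t i) UNIV" "\<And>i. i \<le> card (t i)"
    and nrej: "\<And>i. \<not> rejects U C (t i) (map x [0..<i])"
  shows "char_fun y \<in> fst ` C"
proof -
  note F = ultrafilter_omega_filter[OF U]
  have "\<exists>z. z \<in> stem (t i) UNIV \<and> z \<in> proj_through C (map x [0..<i])" for i
    using nrej[of i] omega_filter_UNIV[OF F] unfolding rejects_def by blast
  then have "\<exists>z \<tau>. z \<in> stem (t i) UNIV \<and> (char_fun z, \<tau>) \<in> C \<and> (\<forall>j<i. \<tau> j = x j)" for i
    by (fastforce simp: proj_through_def)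
  then obtain z \<tau> where z: "\<And>i. z i \<in> stem (t i) UNIV" "\<And>i. (char_fun (z i), \<tau> i) \<in> C"
    "\<And>i j. j < i \<Longrightarrow> \<tau> i j = x j"
    by metis
  \<comment> \<open>An element of \<open>w - t i\<close> lies above the at least \<open>i\<close> elements of \<open>t i\<close>.\<close>
  have seg: "j \<in> w \<longleftrightarrow> j \<in> t i" if w: "w \<in> stem (t i) UNIV" and "j < i" for w i j
  proof
    show "j \<in> t i" if "j \<in> w"
    proof (rule ccontr)
      assume "j \<notin> t i"
      with w \<open>j \<in> w\<close> have "t i \<subseteq> {..<j}" by (auto simp: stem_def)
      then have "card (t i) \<le> j" using card_mono[of "{..<j}" "t i"] by simp
      with t(3)[of i] \<open>j < i\<close> show False by simp
    qed
  qed (use w in \<open>auto simp: stem_def\<close>)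
  have "(\<lambda>i. char_fun (z i)) \<longlonglongrightarrow> char_fun y"
    by (rule tendsto_discrete_pointwise) (simp add: char_fun_def seg[OF z(1)] seg[OF t(2)])
  moreover have "\<tau> \<longlonglongrightarrow> x"
    by (rule tendsto_discrete_pointwise) (rule z(3))
  ultimately have "(\<lambda>i. (char_fun (z i), \<tau> i)) \<longlonglongrightarrow> (char_fun y, x)" by (rule tendsto_Pair)
  with C z(2) have "(char_fun y, x) \<in> C" by (rule closed_sequentially)
  then show ?thesis by force
qed

theorem analytic_homogeneous:
  assumes R: "Ramsey_ultrafilter U" and A: "boldface_Sigma11 A"
  obtains u where "u \<in> U" "\<And>y. infinite y \<Longrightarrow> y \<subseteq> u \<Longrightarrow> char_fun y \<in> A"
    | u where "u \<in> U" "\<And>y. infinite y \<Longrightarrow> y \<subseteq> u \<Longrightarrow> char_fun y \<notin> A"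
proof -
  note UF = Ramsey_ultrafilterD[OF R]
  note F = ultrafilter_omega_filter[OF UF]
  from A obtain C :: "((nat \<Rightarrow> bool) \<times> (nat \<Rightarrow> nat)) set"
    where C: "closed C" "A = fst ` C" by (auto simp: boldface_Sigma11_def)
  show thesis
  proof (cases "rejects U C {} []")
    case True
    then obtain u where "u \<in> U" "stem {} u \<inter> proj_through C [] = {}"
      by (auto simp: rejects_def)
    then show thesis
      using that(2)[of u] C(2) proj_through_Nil stem_empty by blast
  next
    case nrej: False
    define ext where "ext y \<sigma> \<longleftrightarrow> (\<exists>r d. finite r \<and> y \<in> stem r UNIV \<and>
        \<sigma> @ [d] \<in> small_seqs (card r) \<and> \<not> rejects U C r (\<sigma> @ [d]))" for y \<sigma>
    have "\<forall>t \<sigma>. \<exists>W\<in>U. finite t \<longrightarrow> \<not> rejects U C t \<sigma> \<longrightarrow> (\<forall>y\<in>stem t W. ext y \<sigma>)"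
      using omega_filter_UNIV[OF F] not_rejects_extend[OF R] unfolding ext_def by meson
    then obtain W where W: "\<And>t \<sigma>. W t \<sigma> \<in> U"
      "\<And>t \<sigma> y. finite t \<Longrightarrow> \<not> rejects U C t \<sigma> \<Longrightarrow> y \<in> stem t (W t \<sigma>) \<Longrightarrow> ext y \<sigma>"
      by metis
    define V where "V t = (\<Inter>\<sigma>\<in>small_seqs (card t). W t \<sigma>)" for t
    have V: "V t \<in> U" for t
      unfolding V_def by (intro omega_filter_INT[OF F] finite_small_seqs W)
    obtain u where u: "u \<in> U" "\<And>y t. y \<in> stem {} u \<Longrightarrow> finite t \<Longrightarrow> {} \<subseteq> t \<Longrightarrow>
        y \<in> stem t UNIV \<Longrightarrow> y \<in> stem t (V t)"
      using Ramsey_fusion[of U "{}" V, OF R _ V] by blast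
    have "char_fun y \<in> A" if "infinite y" "y \<subseteq> u" for y
    proof -
      have y: "y \<in> stem {} u" using that by (simp add: stem_empty)
      define P where "P i p \<longleftrightarrow> finite (fst p) \<and> y \<in> stem (fst p) UNIV \<and> length (snd p) = i \<and>
          snd p \<in> small_seqs (card (fst p)) \<and> \<not> rejects U C (fst p) (snd p)"
        for i and p :: "nat set \<times> nat list"
      have "\<exists>f. \<forall>i. P i (f i) \<and> (\<exists>d. snd (f (Suc i)) = snd (f i) @ [d])"
      proof (rule dependent_nat_choice)
        show "\<exists>p. P 0 p"
          using nrej stem_UNIV[OF y]
          by (intro exI[of _ "({}, [])"]) (simp add: P_def small_seqs_def)
        fix p i assume p: "P i p"
        then have "y \<in> stem (fst p) (V (fst p))" using u(2)[OF y] by (auto simp: P_def)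
        moreover have "V (fst p) \<subseteq> W (fst p) (snd p)" using p by (auto simp: P_def V_def)
        ultimately have "ext y (snd p)" using p stem_mono W(2) unfolding P_def by blast
        then obtain r d where "finite r" "y \<in> stem r UNIV"
          "snd p @ [d] \<in> small_seqs (card r)" "\<not> rejects U C r (snd p @ [d])"
          by (auto simp: ext_def)
        then show "\<exists>q. P (Suc i) q \<and> (\<exists>d. snd q = snd p @ [d])"
          using p by (intro exI[of _ "(r, snd p @ [d])"]) (simp add: P_def)
      qed
      then obtain f where f: "\<And>i. P i (f i)" "\<And>i. \<exists>d. snd (f (Suc i)) = snd (f i) @ [d]"
        by blast
      define x where "x i = last (snd (f (Suc i)))" for i
      have fx: "snd (f i) = map x [0..<i]" for i
      proof (induction i)
        case 0
        then show ?case using f(1)[of 0] by (simp add: P_def)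
      next
        case (Suc i)
        then show ?case using f(2)[of i] by (auto simp: x_def)
      qed
      have "char_fun y \<in> fst ` C"
      proof (rule not_rejects_chain_limit[OF UF C(1)])
        show "finite (fst (f i))" "y \<in> stem (fst (f i)) UNIV" "i \<le> card (fst (f i))"
          "\<not> rejects U C (fst (f i)) (map x [0..<i])" for i
          using f(1)[of i] fx[of i] by (auto simp: P_def small_seqs_def)
      qed
      then show ?thesis using C(2) by simp
    qed
    with u(1) show thesis by (rule that(1))
  qed
qed

section \<open>Coanalytic bases\<close>

lemma inj_char_fun: "inj char_fun"
  by (rule injI) (auto simp: char_fun_def fun_eq_iff)

theorem theorem1p3:
  fixes U X :: "nat set set"
  assumes "Ramsey_ultrafilter U"
    and "filter_base X U"
  shows "\<not> boldface_Pi11 (char_fun ` X)"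
proof
  assume "boldface_Pi11 (char_fun ` X)"
  then have A: "boldface_Sigma11 (- (char_fun ` X))" by (simp add: boldface_Pi11_def)
  note F = ultrafilter_omega_filter[OF Ramsey_ultrafilterD[OF assms(1)]]
  have X: "X \<subseteq> U" "\<And>u. u \<in> U \<Longrightarrow> \<exists>x\<in>X. x \<subseteq> u" using assms(2) unfolding filter_base_def by fast+
  from assms(1) A show False
  proof (cases rule: analytic_homogeneous)
    case (1 u)
    then obtain x where "x \<in> X" "x \<subseteq> u" using X(2) by blast
    moreover from this have "infinite x" using X(1) omega_filter_infinite[OF F] by blast
    ultimately show False using 1(2)[of x] by simp
  next
    case (2 u)
    have "y \<in> U" if "infinite y" "y \<subseteq> u" for y
      using 2(2)[OF that] X(1) by (auto simp: inj_image_mem_iff[OF inj_char_fun])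
    moreover obtain B D where "B \<subseteq> u" "D \<subseteq> u" "infinite B" "infinite D" and disj: "B \<inter> D = {}"
      using infinite_split[OF omega_filter_infinite[OF F 2(1)]] by blast
    ultimately have "B \<inter> D \<in> U" by (intro omega_filter_Int[OF F])
    then show False using disj omega_filter_nonempty[OF F] by simp
  qed
qed

end
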